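(* Monroe Approval Voting ($\mathit{MonAV}$) satisfies JR: for every ballot profile $\vec{A}=(A_1,\dots,A_n)$ over a candidate set $C$ and every $k$ with $1\le k\le|C|$, every committee that can be output by $\mathit{MonAV}$ on $(\vec{A},k)$ (irrespective of tie-breaking) provides justified representation for $(\vec{A},k)$.
   Context: Setting. $N=\{1,\dots,n\}$ ($n\ge 1$) is a set of voters, $C$ is a finite set of candidates. Each voter $i\in N$ submits an approval ballot $A_i\subseteq C$; the list $\vec{A}=(A_1,\dots,A_n)$ is the ballot profile. An approval-based multi-winner rule takes $(N,C,\vec{A},k)$ with $1\le k\le|C|$ and returns a committee $W\subseteq C$ with $|W|=k$. Justified representation (JR). A set $W\subseteq C$ with $|W|=k$ provides justified representation for $(\vec{A},k)$ if there is no set of voters $N^*\subseteq N$ with $|N^*|\ge \frac{n}{k}$ such that $\bigcap_{i\in N^*}A_i\neq\emptyset$ and $A_i\cap W=\emptyset$ for all $i\in N^*$. $\mathit{MonAV}$: given a committee $W$ of size $k$, a mapping $\pi:N\to W$ is valid if $|\pi^{-1}(c)|\in\{\lfloor\frac nk\rfloor,\lceil\frac nk\rceil\}$ for each $c\in W$. The Monroe score of a valid mapping $\pi$ is the number of voters $i\in N$ with $\pi(i)\in A_i$. The Monroe score of a committee $W$ is the maximum Monroe score of a valid mapping from $N$ to $W$. $\mathit{MonAV}$ returns a size-$k$ committee with the maximum Monroe score. *)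

theory Defs
  imports Complex_Main "HOL-Library.FuncSet"
begin

definition voters :: "nat \<Rightarrow> nat set" where
  "voters n = {1..n}"

definition ballot_profile :: "nat \<Rightarrow> 'c set \<Rightarrow> (nat \<Rightarrow> 'c set) \<Rightarrow> bool" where
  "ballot_profile n C A \<longleftrightarrow> (\<forall>i\<in>voters n. A i \<subseteq> C)"

definition committees :: "'c set \<Rightarrow> nat \<Rightarrow> 'c set set" where
  "committees C k = {W. W \<subseteq> C \<and> card W = k}"

text \<open>For \<open>n \<ge> 1\<close> and \<open>k \<ge> 1\<close> the size condition forces \<open>N\<close> to be nonempty,
  so the empty intersection (which would be \<open>UNIV\<close>) never occurs.\<close>

definition provides_JR :: "nat \<Rightarrow> (nat \<Rightarrow> 'c set) \<Rightarrow> nat \<Rightarrow> 'c set \<Rightarrow> bool" where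
  "provides_JR n A k W \<longleftrightarrow>
     \<not> (\<exists>N \<subseteq> voters n. real (card N) \<ge> real n / real k \<and>
          (\<Inter>i\<in>N. A i) \<noteq> {} \<and> (\<forall>i\<in>N. A i \<inter> W = {}))"

definition valid_mappings :: "nat \<Rightarrow> nat \<Rightarrow> 'c set \<Rightarrow> (nat \<Rightarrow> 'c) set" where
  "valid_mappings n k W =
     {\<pi> \<in> voters n \<rightarrow>\<^sub>E W. \<forall>c\<in>W.
        int (card {i \<in> voters n. \<pi> i = c}) \<in> {\<lfloor>real n / real k\<rfloor>, \<lceil>real n / real k\<rceil>}}"

definition mapping_score :: "nat \<Rightarrow> (nat \<Rightarrow> 'c set) \<Rightarrow> (nat \<Rightarrow> 'c) \<Rightarrow> nat" where
  "mapping_score n A \<pi> = card {i \<in> voters n. \<pi> i \<in> A i}"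

text \<open>The set under \<open>Max\<close> is finite, and it is nonempty whenever \<open>card W = k \<ge> 1\<close>,
  since \<open>n\<close> voters can then be split into \<open>k\<close> groups of almost equal size.\<close>

definition monroe_score :: "nat \<Rightarrow> (nat \<Rightarrow> 'c set) \<Rightarrow> nat \<Rightarrow> 'c set \<Rightarrow> nat" where
  "monroe_score n A k W = Max (mapping_score n A ` valid_mappings n k W)"

text \<open>All committees that the rule can output under some tie-breaking.\<close>

definition MonAV :: "nat \<Rightarrow> 'c set \<Rightarrow> (nat \<Rightarrow> 'c set) \<Rightarrow> nat \<Rightarrow> 'c set set" where
  "MonAV n C A k =
     {W \<in> committees C k. \<forall>W' \<in> committees C k. monroe_score n A k W' \<le> monroe_score n A k W}"

end

theory Submission
  imports Defs
begin

text \<open>Suppose that a group \<open>S\<close> of unrepresented voters witnesses a violation of JR for a winning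
  committee \<open>W\<close>, all of its members approving \<open>c\<close>. Take an optimal mapping \<open>\<pi>\<close>, a voter
  \<open>i \<in> S\<close>, and the set \<open>G\<close> of voters sharing \<open>w = \<pi> i\<close> with \<open>i\<close>.  Since
  \<open>card G \<le> \<lceil>n / k\<rceil> \<le> card S\<close>, we may replace \<open>w\<close> by \<open>c\<close>, assign to \<open>c\<close> a set
  \<open>T \<subseteq> S\<close> of exactly \<open>card G\<close> voters, and let the voters displaced from \<open>G - T\<close> take the
  places vacated by \<open>T - G\<close>. Nobody in \<open>T\<close> was satisfied before and everybody in \<open>T\<close> is
  satisfied afterwards; at most \<open>card G - 1\<close> satisfied voters in \<open>G\<close> are lost, as \<open>i\<close> was not
  satisfied. So the Monroe score strictly increases.\<close>

text \<open>Induction on \<open>n\<close>: the offset \<open>k - 1 - r\<close> shifts the quotient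
  so that it jumps in passing from \<open>n\<close> to \<open>Suc n\<close> exactly when
  \<open>n mod k = r\<close>, which is when the counted set gains the element
  \<open>n\<close>.\<close>

lemma card_mod_eq_lessThan:
  fixes n k r :: nat
  assumes "r < k"
  shows "card {j. j < n \<and> j mod k = r} = (n + (k - 1 - r)) div k"
proof (induction n)
  case 0
  then show ?case using assms by simp
next
  case (Suc n)
  have split: "{j. j < Suc n \<and> j mod k = r} =
      (if n mod k = r then insert n {j. j < n \<and> j mod k = r} else {j. j < n \<and> j mod k = r})"
    by (auto simp: less_Suc_eq)
  have "(Suc (n + (k - 1 - r)) mod k = 0) = (n mod k = r)"
  proof -
    have "Suc (n + (k - 1 - r)) = n + (k - r)" using assms by simp
    then have "(Suc (n + (k - 1 - r)) mod k = 0) = ((n mod k + (k - r)) mod k = 0)"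
      by (simp only: mod_add_left_eq)
    also have "\<dots> = (n mod k = r)"
    \<comment> \<open>Below \<open>r\<close> the sum lies strictly between 0 and \<open>k\<close>;
      otherwise subtracting \<open>k\<close> leaves the residue \<open>n mod k - r\<close>.\<close>
    proof (cases "n mod k < r")
      case True
      then show ?thesis using assms by simp
    next
      case False
      have "n mod k + (k - r) = (n mod k - r) + k" using False assms by simp
      then have "(n mod k + (k - r)) mod k = (n mod k - r) mod k"
        by (simp only: mod_add_self2)
      also have "\<dots> = n mod k - r"
        using assms by (intro mod_less less_imp_diff_less) simp
      finally show ?thesis using False by simp
    qed
    finally show ?thesis .
  qed
  then have "(Suc n + (k - 1 - r)) div k =
      (if n mod k = r then Suc ((n + (k - 1 - r)) div k) else (n + (k - 1 - r)) div k)"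
    by (simp only: add_Suc div_Suc)
  then show ?case using Suc.IH unfolding split by (simp only: if_distrib[of card]) simp
qed

lemma finite_valid_mappings:
  assumes "finite W"
  shows "finite (valid_mappings n k W)"
  by (rule finite_subset[of _ "voters n \<rightarrow>\<^sub>E W"])
    (use assms in \<open>auto simp: valid_mappings_def voters_def intro!: finite_PiE\<close>)

text \<open>Dealing the voters out to the members of \<open>W\<close> in cyclic order gives groups
  of almost equal size. This is what makes the maximum in \<open>monroe_score\<close>
  attained.\<close>

lemma valid_mappings_nonempty:
  assumes "finite W" "card W = k" "k \<ge> 1"
  shows "valid_mappings n k W \<noteq> {}"
proof -
  obtain f where f: "bij_betw f {0..<k} W"
    using ex_bij_betw_nat_finite[OF assms(1)] assms(2) by blast
  \<comment> \<open>Voters are numbered from 1, residues from 0, hence the shift.\<close>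
  define p where "p = (\<lambda>i\<in>voters n. f ((i - 1) mod k))"
  have lt: "m mod k < k" for m using assms by simp
  have "p \<in> voters n \<rightarrow>\<^sub>E W"
    using bij_betwE[OF f] lt unfolding p_def by auto
  moreover have "int (card {i \<in> voters n. p i = c}) \<in> {\<lfloor>real n / real k\<rfloor>, \<lceil>real n / real k\<rceil>}"
    if "c \<in> W" for c
  proof -
    obtain r where r: "r < k" "f r = c"
      using f \<open>c \<in> W\<close> by (auto simp: bij_betw_def)
    have "{i \<in> voters n. p i = c} = Suc ` {j. j < n \<and> j mod k = r}"
    proof -
      have "p (Suc j) = c \<longleftrightarrow> j mod k = r" if "j < n" for j
        using f r lt that by (auto simp: p_def voters_def bij_betw_def dest: inj_onD)
      moreover have "voters n = Suc ` {j. j < n}"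
        by (simp add: voters_def image_Suc_lessThan flip: lessThan_def)
      ultimately show ?thesis by auto
    qed
    then have card: "card {i \<in> voters n. p i = c} = (n + (k - 1 - r)) div k"
      using card_mod_eq_lessThan[OF r(1)] by (simp add: card_image)
    define q where "q = (n + (k - 1 - r)) div k"
    have "q * k \<le> n + (k - 1 - r)" "n + (k - 1 - r) < (q + 1) * k"
      using assms by (simp_all add: q_def dividend_less_div_times)
    then have "real (q * k) < real (n + k)" "real n < real ((q + 1) * k)"
      using r(1) by linarith+
    \<comment> \<open>An integer at distance less than 1 from n/k can only be its floor or its
      ceiling.\<close>
    then have "real q < real n / real k + 1" "real n / real k < real q + 1"
      using assms(3) by (simp_all add: field_simps)
    then have "int q = \<lfloor>real n / real k\<rfloor> \<or> int q = \<lceil>real n / real k\<rceil>"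
      by linarith
    then show ?thesis using card q_def by simp
  qed
  ultimately show ?thesis unfolding valid_mappings_def by blast
qed

lemma card_Collect_bij_betw:
  assumes "bij_betw h X Y"
  shows "card {x \<in> X. P (h x)} = card {y \<in> Y. P y}"
proof -
  have "bij_betw h {x \<in> X. P (h x)} {y \<in> Y. P y}"
    using assms by (auto simp: bij_betw_def inj_on_def)
  then show ?thesis by (rule bij_betw_same_card)
qed

text \<open>\<open>G - T\<close> and \<open>T - G\<close> have equal size, so a bijection between
  them can be glued to the identity outside \<open>T \<union> G\<close>. Here \<open>h i\<close> is
  the voter whose old place \<open>i\<close> takes over.\<close>

lemma ex_bij_betw_Diff:
  assumes "finite N" "T \<subseteq> N" "G \<subseteq> N" "card T = card G"
  shows "\<exists>h. bij_betw h (N - T) (N - G) \<and> (\<forall>i. i \<notin> G \<longrightarrow> h i = i)"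
proof -
  have fin: "finite T" "finite G" using assms finite_subset by auto
  have "card (G - T) = card (T - G)"
    using assms(4) fin by (metis card_Diff_subset_Int finite_Int Int_commute)
  then obtain g where g: "bij_betw g (G - T) (T - G)"
    using fin finite_same_card_bij by (metis finite_Diff)
  define h where "h i = (if i \<in> G then g i else i)" for i
  have "bij_betw h (G - T) (T - G)"
    using g by (rule bij_betw_cong[THEN iffD1, rotated]) (simp add: h_def)
  moreover have "bij_betw h (N - (T \<union> G)) (N - (T \<union> G))"
    by (rule bij_betw_cong[THEN iffD1, of _ id]) (auto simp: h_def)
  ultimately have "bij_betw h ((G - T) \<union> (N - (T \<union> G))) ((T - G) \<union> (N - (T \<union> G)))"
    by (rule bij_betw_combine) auto
  moreover have "(G - T) \<union> (N - (T \<union> G)) = N - T" "(T - G) \<union> (N - (T \<union> G)) = N - G"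
    using assms by auto
  ultimately have "bij_betw h (N - T) (N - G)" by simp
  then show ?thesis by (auto simp: h_def)
qed

text \<open>Since \<open>T\<close> is as large as the group of \<open>i0\<close>, the newcomer
  \<open>c\<close> inherits the group size of \<open>\<pi> i0\<close>, which keeps the new mapping
  valid.\<close>

lemma improving_exchange:
  assumes \<pi>: "\<pi> \<in> valid_mappings n k W"
    and c: "c \<notin> W"
    and i0: "i0 \<in> voters n" "\<pi> i0 \<notin> A i0"
    and T: "T \<subseteq> voters n" "card T = card {i \<in> voters n. \<pi> i = \<pi> i0}"
    and unsat: "\<And>i. i \<in> T \<Longrightarrow> \<pi> i \<notin> A i"
    and sat: "\<And>i. i \<in> T \<Longrightarrow> c \<in> A i"
  shows "\<exists>\<rho> \<in> valid_mappings n k (insert c (W - {\<pi> i0})).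
           mapping_score n A \<pi> < mapping_score n A \<rho>"
proof -
  define w where "w = \<pi> i0"
  define G where "G = {i \<in> voters n. \<pi> i = w}"
  have fin: "finite (voters n)" by (simp add: voters_def)
  have G: "G \<subseteq> voters n" "card T = card G" "i0 \<in> G"
    using T i0 by (auto simp: G_def w_def)
  have \<pi>W: "\<pi> i \<in> W" if "i \<in> voters n" for i
    using \<pi> that by (auto simp: valid_mappings_def)
  obtain h where h: "bij_betw h (voters n - T) (voters n - G)"
    and h_id: "\<And>i. i \<notin> G \<Longrightarrow> h i = i"
    using ex_bij_betw_Diff[OF fin T(1) G(1,2)] by blast
  have hN: "h i \<in> voters n - G" if "i \<in> voters n - T" for i
    using bij_betwE[OF h] that by blast
  have \<pi>h: "\<pi> (h i) \<in> W - {w}" if "i \<in> voters n - T" for i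
    using hN[OF that] \<pi>W by (auto simp: G_def)
  \<comment> \<open>Outside \<open>T\<close> the new mapping is \<open>\<pi>\<close> transported
    along \<open>h\<close>. As \<open>h\<close> maps onto the complement of \<open>G\<close>, no
    voter is sent to \<open>w\<close> and every other old member keeps its group size.\<close>
  define \<rho> where "\<rho> = (\<lambda>i\<in>voters n. if i \<in> T then c else \<pi> (h i))"
  have "\<rho> \<in> voters n \<rightarrow>\<^sub>E insert c (W - {w})"
    using \<pi>h by (auto simp: \<rho>_def)
  moreover have "int (card {i \<in> voters n. \<rho> i = d}) \<in> {\<lfloor>real n / real k\<rfloor>, \<lceil>real n / real k\<rceil>}"
    if "d \<in> insert c (W - {w})" for d
  proof (cases "d = c")
    case True
    have "{i \<in> voters n. \<rho> i = c} = T"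
      using T(1) \<pi>h c by (fastforce simp: \<rho>_def)
    then have "card {i \<in> voters n. \<rho> i = d} = card {i \<in> voters n. \<pi> i = w}"
      using True G(2) by (simp add: G_def)
    moreover have "w \<in> W" using \<pi>W i0 by (simp add: w_def)
    ultimately show ?thesis using \<pi> by (auto simp: valid_mappings_def)
  next
    case False
    then have d: "d \<in> W" "d \<noteq> w" using that by auto
    have "{i \<in> voters n. \<rho> i = d} = {i \<in> voters n - T. \<pi> (h i) = d}"
      using False by (auto simp: \<rho>_def)
    moreover have "{j \<in> voters n - G. \<pi> j = d} = {j \<in> voters n. \<pi> j = d}"
      using d by (auto simp: G_def)
    ultimately have "card {i \<in> voters n. \<rho> i = d} = card {i \<in> voters n. \<pi> i = d}"
      using card_Collect_bij_betw[OF h, of "\<lambda>j. \<pi> j = d"] by simp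
    then show ?thesis using \<pi> d by (auto simp: valid_mappings_def)
  qed
  ultimately have "\<rho> \<in> valid_mappings n k (insert c (W - {w}))"
    by (simp add: valid_mappings_def)
  moreover have "mapping_score n A \<pi> < mapping_score n A \<rho>"
  proof -
    \<comment> \<open>The voters in \<open>R\<close> are fixed by \<open>h\<close> and stay
      satisfied, so both scores are compared through \<open>R\<close>: the old one is at most
      \<open>card G - 1 + card R\<close>, the new one at least
      \<open>card T + card R\<close>.\<close>
    define R where "R = {i \<in> voters n - (T \<union> G). \<pi> i \<in> A i}"
    have finTGR: "finite T" "finite G" "finite R"
      using fin T(1) G(1) finite_subset by (auto simp: R_def)
    have "{i \<in> voters n. \<pi> i \<in> A i} \<subseteq> (G - {i0}) \<union> R"
      using unsat i0 by (auto simp: R_def)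
    then have "mapping_score n A \<pi> \<le> card ((G - {i0}) \<union> R)"
      unfolding mapping_score_def using finTGR by (intro card_mono) auto
    also have "\<dots> \<le> card (G - {i0}) + card R" by (rule card_Un_le)
    also have "\<dots> < card T + card R"
      using G(2) card_Diff1_less[OF finTGR(2) G(3)] by linarith
    also have "\<dots> = card (T \<union> R)"
      using finTGR by (intro card_Un_disjoint[symmetric]) (auto simp: R_def)
    also have "\<dots> \<le> mapping_score n A \<rho>"
      unfolding mapping_score_def using T(1) sat fin h_id
      by (intro card_mono) (auto simp: R_def \<rho>_def)
    finally show ?thesis .
  qed
  ultimately show ?thesis by (auto simp: w_def)
qed

theorem theorem9:
  fixes n k :: nat and C :: "'c set" and A :: "nat \<Rightarrow> 'c set" and W :: "'c set"
  assumes "n \<ge> 1"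
    and "finite C"
    and "ballot_profile n C A"
    and "1 \<le> k" and "k \<le> card C"
    and "W \<in> MonAV n C A k"
  shows "provides_JR n A k W"
proof (rule ccontr)
  assume "\<not> provides_JR n A k W"
  then obtain S where S: "S \<subseteq> voters n" "real n / real k \<le> real (card S)"
    and common: "(\<Inter>i\<in>S. A i) \<noteq> {}"
    and disj: "\<And>i. i \<in> S \<Longrightarrow> A i \<inter> W = {}"
    unfolding provides_JR_def by auto
  from common obtain c where c: "\<And>i. i \<in> S \<Longrightarrow> c \<in> A i"
    by auto
  \<comment> \<open>Positivity of n/k makes \<open>S\<close> nonempty, which supplies the voter
    \<open>i0\<close>.\<close>
  have "real n / real k > 0" using assms(1,4) by simp
  then have "S \<noteq> {}" using S(2) by auto
  then obtain i0 where i0: "i0 \<in> S" by blast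
  have W: "W \<subseteq> C" "card W = k"
    and opt: "\<And>W'. W' \<in> committees C k \<Longrightarrow> monroe_score n A k W' \<le> monroe_score n A k W"
    using assms(6) by (auto simp: MonAV_def committees_def)
  have finW: "finite W" using W(1) assms(2) finite_subset by blast
  have cW: "c \<notin> W" "c \<in> C"
    using c[OF i0] disj[OF i0] assms(3) i0 S(1) by (auto simp: ballot_profile_def)
  have "monroe_score n A k W \<in> mapping_score n A ` valid_mappings n k W"
    unfolding monroe_score_def
    using finite_valid_mappings[OF finW] valid_mappings_nonempty[OF finW W(2) assms(4)]
    by (intro Max_in) auto
  then obtain \<pi> where \<pi>: "\<pi> \<in> valid_mappings n k W" "mapping_score n A \<pi> = monroe_score n A k W"
    by auto
  have \<pi>W: "\<pi> i \<in> W" if "i \<in> S" for i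
    using \<pi>(1) that S(1) by (auto simp: valid_mappings_def)
  have unsat: "\<pi> i \<notin> A i" if "i \<in> S" for i
    using \<pi>W[OF that] disj[OF that] by blast
  have "int (card {i \<in> voters n. \<pi> i = \<pi> i0}) \<in> {\<lfloor>real n / real k\<rfloor>, \<lceil>real n / real k\<rceil>}"
    using \<pi>(1) \<pi>W[OF i0] by (auto simp: valid_mappings_def)
  \<comment> \<open>As \<open>card S\<close> is an integer, being at least n/k means being at least
    the ceiling of n/k.\<close>
  then have "card {i \<in> voters n. \<pi> i = \<pi> i0} \<le> card S"
    using S(2) by (simp, linarith)
  then obtain T where T: "T \<subseteq> S" "card T = card {i \<in> voters n. \<pi> i = \<pi> i0}"
    by (meson obtain_subset_with_card_n)
  let ?W' = "insert c (W - {\<pi> i0})"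
  obtain \<rho> where \<rho>: "\<rho> \<in> valid_mappings n k ?W'" "mapping_score n A \<pi> < mapping_score n A \<rho>"
    using improving_exchange[OF \<pi>(1) cW(1), of i0 A T] T S(1) i0 unsat c by blast
  have "mapping_score n A \<rho> \<le> monroe_score n A k ?W'"
    unfolding monroe_score_def
    using \<rho>(1) finite_valid_mappings[of ?W' n k] finW by (intro Max_ge) auto
  \<comment> \<open>The size stays \<open>k\<close> because \<open>\<pi> i0\<close> is in
    \<open>W\<close> and \<open>c\<close> is not.\<close>
  moreover have "?W' \<in> committees C k"
    using W cW \<pi>W[OF i0] finW assms(4) by (auto simp: committees_def card_Diff_singleton)
  ultimately show False
    using opt[of ?W'] \<rho>(2) \<pi>(2) by linarith
qed

end
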